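(* Let $R$ be a ring and let $\mu_M\colon M_0\to M_1$ be an object $M$ of $\mathrm{Morph}(\mathrm{Mod}\text{-}R)$ with $M_0$ and $M_1$ non-zero uniserial right $R$-modules. Then the endomorphism ring $E_M$ of $M$ in $\mathrm{Morph}(\mathrm{Mod}\text{-}R)$ has at most four maximal right (respectively, left) ideals, which are among the completely prime two-sided ideals $$I_0:=\{(u_0,u_1)\in E_M\mid u_0\text{ is not an injective right }R\text{-module morphism}\},$$ $$I_1:=\{(u_0,u_1)\in E_M\mid u_1\text{ is not an injective right }R\text{-module morphism}\},$$ $$K_0:=\{(u_0,u_1)\in E_M\mid u_0\text{ is not a surjective right }R\text{-module morphism}\},$$ $$K_1:=\{(u_0,u_1)\in E_M\mid u_1\text{ is not a surjective right }R\text{-module morphism}\}.$$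
   Context: Rings are associative with identity $1\neq 0$. A module is uniserial if the lattice of its submodules is linearly ordered under inclusion. $\mathrm{Morph}(\mathrm{Mod}\text{-}R)$ is the category whose objects are the right $R$-module homomorphisms; an object $M$ is a homomorphism $\mu_M\colon M_0\to M_1$. A morphism $u\colon M\to N$ is a pair $(u_0,u_1)$ of right $R$-module homomorphisms $u_0\colon M_0\to N_0$, $u_1\colon M_1\to N_1$ with $u_1\mu_M=\mu_N u_0$; composition and addition are componentwise. Thus $E_M$ is the set of all $(u_0,u_1)\in \mathrm{End}_R(M_0)\times\mathrm{End}_R(M_1)$ with $u_1\mu_M=\mu_M u_0$, with componentwise operations. A completely prime ideal of a ring $S$ is a proper ideal $P$ of $S$ such that, for all $x,y\in S$, $xy\in P$ implies $x\in P$ or $y\in P$. *)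

theory Defs
  imports "HOL-Algebra.Ideal"
begin

section \<open>Right modules over a (not necessarily commutative) ring\<close>

text \<open>As in HOL-Algebra's record for modules over commutative rings, the additive
  group is carried by a ring record, whose multiplication and one are irrelevant.\<close>

record ('r, 'a) rmodule = "'a ring" +
  rsmult :: "'a \<Rightarrow> 'r \<Rightarrow> 'a"  (infixl \<open>\<cdot>\<index>\<close> 70)

locale right_module = R?: ring R + M?: abelian_group M
  for R :: "('r, 'k) ring_scheme" (structure) and M :: "('r, 'a, 'm) rmodule_scheme" (structure) +
  assumes rsmult_closed:
      "\<lbrakk>x \<in> carrier M; r \<in> carrier R\<rbrakk> \<Longrightarrow> x \<cdot>\<^bsub>M\<^esub> r \<in> carrier M"
    and rsmult_r_distr:
      "\<lbrakk>x \<in> carrier M; r \<in> carrier R; s \<in> carrier R\<rbrakk> \<Longrightarrow>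
        x \<cdot>\<^bsub>M\<^esub> (r \<oplus>\<^bsub>R\<^esub> s) = x \<cdot>\<^bsub>M\<^esub> r \<oplus>\<^bsub>M\<^esub> x \<cdot>\<^bsub>M\<^esub> s"
    and rsmult_l_distr:
      "\<lbrakk>x \<in> carrier M; y \<in> carrier M; r \<in> carrier R\<rbrakk> \<Longrightarrow>
        (x \<oplus>\<^bsub>M\<^esub> y) \<cdot>\<^bsub>M\<^esub> r = x \<cdot>\<^bsub>M\<^esub> r \<oplus>\<^bsub>M\<^esub> y \<cdot>\<^bsub>M\<^esub> r"
    and rsmult_assoc:
      "\<lbrakk>x \<in> carrier M; r \<in> carrier R; s \<in> carrier R\<rbrakk> \<Longrightarrow>
        x \<cdot>\<^bsub>M\<^esub> (r \<otimes>\<^bsub>R\<^esub> s) = (x \<cdot>\<^bsub>M\<^esub> r) \<cdot>\<^bsub>M\<^esub> s"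
    and rsmult_one:
      "x \<in> carrier M \<Longrightarrow> x \<cdot>\<^bsub>M\<^esub> \<one>\<^bsub>R\<^esub> = x"

definition rsubmodule ::
  "('r, 'k) ring_scheme \<Rightarrow> ('r, 'a, 'm) rmodule_scheme \<Rightarrow> 'a set \<Rightarrow> bool" where
  "rsubmodule R M N \<longleftrightarrow>
     additive_subgroup N M \<and> (\<forall>x\<in>N. \<forall>r\<in>carrier R. x \<cdot>\<^bsub>M\<^esub> r \<in> N)"

definition uniserial ::
  "('r, 'k) ring_scheme \<Rightarrow> ('r, 'a, 'm) rmodule_scheme \<Rightarrow> bool" where
  "uniserial R M \<longleftrightarrow>
     right_module R M \<and>
     (\<forall>N N'. rsubmodule R M N \<and> rsubmodule R M N' \<longrightarrow> N \<subseteq> N' \<or> N' \<subseteq> N)"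

text \<open>Homomorphisms are taken extensional (\<^const>\<open>undefined\<close> outside the carrier), so
  that equality of homomorphisms is HOL equality.\<close>

definition rmod_hom ::
  "('r, 'k) ring_scheme \<Rightarrow> ('r, 'a, 'm) rmodule_scheme \<Rightarrow> ('r, 'b, 'n) rmodule_scheme
     \<Rightarrow> ('a \<Rightarrow> 'b) set" where
  "rmod_hom R M N =
     {f \<in> carrier M \<rightarrow>\<^sub>E carrier N.
        (\<forall>x\<in>carrier M. \<forall>y\<in>carrier M. f (x \<oplus>\<^bsub>M\<^esub> y) = f x \<oplus>\<^bsub>N\<^esub> f y) \<and>
        (\<forall>x\<in>carrier M. \<forall>r\<in>carrier R. f (x \<cdot>\<^bsub>M\<^esub> r) = f x \<cdot>\<^bsub>N\<^esub> r)}"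


section \<open>The category of morphisms of right modules\<close>

record ('r, 'a, 'b) morph_obj =
  src :: "('r, 'a) rmodule"
  tgt :: "('r, 'b) rmodule"
  arr :: "'a \<Rightarrow> 'b"

definition is_morph_obj ::
  "('r, 'k) ring_scheme \<Rightarrow> ('r, 'a, 'b) morph_obj \<Rightarrow> bool" where
  "is_morph_obj R M \<longleftrightarrow>
     right_module R (src M) \<and> right_module R (tgt M) \<and> arr M \<in> rmod_hom R (src M) (tgt M)"

definition morph_hom ::
  "('r, 'k) ring_scheme \<Rightarrow> ('r, 'a, 'b) morph_obj \<Rightarrow> ('r, 'c, 'd) morph_obj
     \<Rightarrow> (('a \<Rightarrow> 'c) \<times> ('b \<Rightarrow> 'd)) set" where
  "morph_hom R M N =
     {(u0, u1) \<in> rmod_hom R (src M) (src N) \<times> rmod_hom R (tgt M) (tgt N).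
        \<forall>x\<in>carrier (src M). u1 (arr M x) = arr N (u0 x)}"

definition morph_End ::
  "('r, 'k) ring_scheme \<Rightarrow> ('r, 'a, 'b) morph_obj \<Rightarrow> (('a \<Rightarrow> 'a) \<times> ('b \<Rightarrow> 'b)) ring" where
  "morph_End R M =
     \<lparr>carrier = morph_hom R M M,
      monoid.mult = (\<lambda>(u0, u1) (v0, v1).
        (compose (carrier (src M)) u0 v0, compose (carrier (tgt M)) u1 v1)),
      one = (\<lambda>x\<in>carrier (src M). x, \<lambda>x\<in>carrier (tgt M). x),
      zero = (\<lambda>x\<in>carrier (src M). \<zero>\<^bsub>src M\<^esub>, \<lambda>x\<in>carrier (tgt M). \<zero>\<^bsub>tgt M\<^esub>),
      add = (\<lambda>(u0, u1) (v0, v1).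
        (\<lambda>x\<in>carrier (src M). u0 x \<oplus>\<^bsub>src M\<^esub> v0 x,
         \<lambda>x\<in>carrier (tgt M). u1 x \<oplus>\<^bsub>tgt M\<^esub> v1 x))\<rparr>"

definition nonmono_src where
  "nonmono_src R M =
     {(u0, u1) \<in> carrier (morph_End R M). \<not> inj_on u0 (carrier (src M))}"

definition nonmono_tgt where
  "nonmono_tgt R M =
     {(u0, u1) \<in> carrier (morph_End R M). \<not> inj_on u1 (carrier (tgt M))}"

definition nonepi_src where
  "nonepi_src R M =
     {(u0, u1) \<in> carrier (morph_End R M). u0 ` carrier (src M) \<noteq> carrier (src M)}"

definition nonepi_tgt where
  "nonepi_tgt R M =
     {(u0, u1) \<in> carrier (morph_End R M). u1 ` carrier (tgt M) \<noteq> carrier (tgt M)}"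


section \<open>One-sided and completely prime ideals\<close>

definition right_ideal :: "'a set \<Rightarrow> ('a, 'k) ring_scheme \<Rightarrow> bool" where
  "right_ideal J S \<longleftrightarrow>
     additive_subgroup J S \<and> (\<forall>x\<in>J. \<forall>s\<in>carrier S. x \<otimes>\<^bsub>S\<^esub> s \<in> J)"

definition left_ideal :: "'a set \<Rightarrow> ('a, 'k) ring_scheme \<Rightarrow> bool" where
  "left_ideal J S \<longleftrightarrow>
     additive_subgroup J S \<and> (\<forall>x\<in>J. \<forall>s\<in>carrier S. s \<otimes>\<^bsub>S\<^esub> x \<in> J)"

definition maximal_right_ideal :: "'a set \<Rightarrow> ('a, 'k) ring_scheme \<Rightarrow> bool" where
  "maximal_right_ideal J S \<longleftrightarrow>
     right_ideal J S \<and> J \<noteq> carrier S \<and>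
     (\<forall>J'. right_ideal J' S \<and> J \<subseteq> J' \<longrightarrow> J' = J \<or> J' = carrier S)"

definition maximal_left_ideal :: "'a set \<Rightarrow> ('a, 'k) ring_scheme \<Rightarrow> bool" where
  "maximal_left_ideal J S \<longleftrightarrow>
     left_ideal J S \<and> J \<noteq> carrier S \<and>
     (\<forall>J'. left_ideal J' S \<and> J \<subseteq> J' \<longrightarrow> J' = J \<or> J' = carrier S)"

text \<open>Note that \<^const>\<open>ideal\<close> is two-sided and includes the ring axioms for the ambient ring.\<close>

definition completely_prime_ideal :: "'a set \<Rightarrow> ('a, 'k) ring_scheme \<Rightarrow> bool" where
  "completely_prime_ideal P S \<longleftrightarrow>
     ideal P S \<and> P \<noteq> carrier S \<and>
     (\<forall>x\<in>carrier S. \<forall>y\<in>carrier S. x \<otimes>\<^bsub>S\<^esub> y \<in> P \<longrightarrow> x \<in> P \<or> y \<in> P)"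

end

theory Submission
  imports Defs "HOL-Algebra.Subrings" "HOL-Algebra.Chinese_Remainder"
begin

text \<open>
  An endomorphism of a non-zero uniserial module can fail to be bijective by having a non-zero
  kernel or a proper image.  Since any two submodules are comparable, two non-zero submodules
  meet in a non-zero one and two proper submodules have a proper sum.  The first fact
  makes the non-injective endomorphisms closed under addition, the second the non-surjective
  ones.  Comparing the kernel of \<open>f\<close> with the image of \<open>g\<close> shows moreover that \<open>f g\<close> is
  injective (surjective) only if both \<open>f\<close> and \<open>g\<close> are.  As zero belongs to both sets and the
  identity to neither, they are completely prime ideals of the endomorphism ring of the module
  (\<open>not_inj_completely_prime\<close>, \<open>not_surj_completely_prime\<close>).

  The ring \<open>E\<close> of endomorphisms of a morphism \<open>M\<close> is a subring of the product of the
  endomorphism rings of source and target, and the four sets in question are the preimages of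
  the above ideals under the two projections, hence completely prime.  A pair
  outside all four has bijective components, and the pair of inverses again commutes with the
  arrow of \<open>M\<close>; so \<open>E\<close> consists of its units and the union of the four ideals
  (\<open>morph_End_unitI\<close>).

  A proper one-sided ideal contains no unit, so a maximal one lies in that union.  Prime
  avoidance, valid in a non-commutative ring for completely prime ideals
  (\<open>completely_prime_avoidance\<close>), puts it into a single one of the four, and by maximality
  it is equal to that one.
\<close>

(* The centred dot also denotes the product of ideals; here it is kept for the module action. *)
no_notation ideal_prod (infixl \<open>\<cdot>\<index>\<close> 80)

section \<open>Completely prime ideals and one-sided maximal ideals\<close>

text \<open>The equivalence for products yields absorption on both sides as well as complete primality.
  It also gives closure under negation, as \<open>- x\<close> is the product of \<open>- 1\<close> and \<open>x\<close>; so for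
  the additive structure only zero and sums remain.\<close>

lemma completely_prime_idealI:
  fixes S (structure)
  assumes "ring S" and sub: "P \<subseteq> carrier S" and zero: "\<zero> \<in> P" and one: "\<one> \<notin> P"
    and add: "\<And>x y. \<lbrakk>x \<in> P; y \<in> P\<rbrakk> \<Longrightarrow> x \<oplus> y \<in> P"
    and mult: "\<And>x y. \<lbrakk>x \<in> carrier S; y \<in> carrier S\<rbrakk> \<Longrightarrow> x \<otimes> y \<in> P \<longleftrightarrow> x \<in> P \<or> y \<in> P"
  shows "completely_prime_ideal P S"
proof -
  interpret ring S by fact
  have "\<ominus> x \<in> P" if "x \<in> P" for x
  proof -
    have "x \<in> carrier S" using that sub by blast
    then have "\<ominus> x = (\<ominus> \<one>) \<otimes> x" by (simp add: l_minus)
    then show ?thesis using mult[of "\<ominus> \<one>" x] that \<open>x \<in> carrier S\<close> by simp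
  qed
  then have "subgroup P (add_monoid S)"
    using sub zero add by (intro add.subgroupI) auto
  then have "ideal P S"
    using sub mult by (intro idealI) (auto intro: ring_axioms)
  then show ?thesis
    using one mult by (auto simp: completely_prime_ideal_def)
qed

lemma completely_prime_ideal_vimage:
  assumes "ring_hom_ring S T h" and P: "completely_prime_ideal P T"
  shows "completely_prime_ideal {x \<in> carrier S. h x \<in> P} S"
proof -
  interpret ring_hom_ring S T h by fact
  have "ideal P T" using P by (simp add: completely_prime_ideal_def)
  then interpret P: ideal P T .
  have "\<one>\<^bsub>T\<^esub> \<notin> P"
    using P P.one_imp_carrier by (auto simp: completely_prime_ideal_def)
  then have "\<one>\<^bsub>S\<^esub> \<notin> {x \<in> carrier S. h x \<in> P}" by simp
  then have "{x \<in> carrier S. h x \<in> P} \<noteq> carrier S" using R.one_closed by blast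
  then show ?thesis
    using P ideal_vimage[OF \<open>ideal P T\<close>] by (simp add: completely_prime_ideal_def)
qed

text \<open>The witness is the product of an element of \<open>J\<close> outside \<open>P\<close> with, for each \<open>Q\<close> in \<open>F\<close>, an
  element of \<open>J\<close> in \<open>Q\<close> outside \<open>P\<close>: it lies in every \<open>Q\<close> because these are two-sided, and it
  stays outside \<open>P\<close> because \<open>P\<close> is completely prime.\<close>

lemma completely_prime_avoid_simultaneous:
  fixes S (structure)
  assumes "finite F" and "\<And>Q. Q \<in> F \<Longrightarrow> ideal Q S"
    and P: "completely_prime_ideal P S"
    and J: "J \<subseteq> carrier S" "\<not> J \<subseteq> P" "\<And>x y. \<lbrakk>x \<in> J; y \<in> J\<rbrakk> \<Longrightarrow> x \<otimes> y \<in> J"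
    and "\<And>Q. Q \<in> F \<Longrightarrow> \<exists>x\<in>J. x \<in> Q \<and> x \<notin> P"
  shows "\<exists>z\<in>J. z \<notin> P \<and> (\<forall>Q\<in>F. z \<in> Q)"
  using assms(1,2) assms(7)
proof (induction F rule: finite_induct)
  case empty
  then show ?case using J by blast
next
  case (insert Q F)
  then obtain z where z: "z \<in> J" "z \<notin> P" "\<forall>Q\<in>F. z \<in> Q" by blast
  obtain x where x: "x \<in> J" "x \<in> Q" "x \<notin> P" using insert.prems(2) by blast
  have "z \<otimes> x \<notin> P"
    using P x z J(1) unfolding completely_prime_ideal_def by blast
  moreover have "z \<otimes> x \<in> Q'" if "Q' \<in> insert Q F" for Q'
  proof -
    interpret ideal Q' S by (rule insert.prems(1)[OF that])
    have "z \<in> carrier S" "x \<in> carrier S" using x(1) z(1) J(1) by auto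
    then show ?thesis using that x(2) z(3) I_l_closed I_r_closed by blast
  qed
  ultimately show ?case using J(3) x z by blast
qed

text \<open>Prime avoidance.  Asking of \<open>J\<close> only closure under sums and products lets the same statement
  serve left and right ideals.  One may assume the family irredundant.  If \<open>J\<close> were
  not inside \<open>P\<close>, take \<open>x\<close> in \<open>J\<close> that lies in \<open>P\<close> but in no other member, and \<open>z\<close> in \<open>J\<close>
  that lies in all other members but not in \<open>P\<close>; then \<open>x + z\<close> lies in no member at all, since
  a member containing the sum and one summand contains the other.\<close>

lemma completely_prime_avoidance:
  fixes S (structure)
  assumes "finite \<P>" and "\<And>P. P \<in> \<P> \<Longrightarrow> completely_prime_ideal P S"
    and J: "J \<subseteq> carrier S" "J \<noteq> {}"
      "\<And>x y. \<lbrakk>x \<in> J; y \<in> J\<rbrakk> \<Longrightarrow> x \<oplus> y \<in> J" "\<And>x y. \<lbrakk>x \<in> J; y \<in> J\<rbrakk> \<Longrightarrow> x \<otimes> y \<in> J"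
    and "J \<subseteq> \<Union>\<P>"
  shows "\<exists>P\<in>\<P>. J \<subseteq> P"
  using assms(1,2,7)
proof (induction \<P> rule: finite_psubset_induct)
  case (psubset \<P>)
  show ?case
  proof (cases "\<exists>P\<in>\<P>. J \<subseteq> \<Union>(\<P> - {P})")
    case True
    then obtain P where "P \<in> \<P>" "J \<subseteq> \<Union>(\<P> - {P})" by blast
    then show ?thesis using psubset.IH[of "\<P> - {P}"] psubset.prems(1) by blast
  next
    case False
    obtain P where P: "P \<in> \<P>" using J(2) psubset.prems(2) by blast
    have cp: "completely_prime_ideal P S" by (rule psubset.prems(1)[OF P])
    have id: "ideal Q S" if "Q \<in> \<P>" for Q
      using psubset.prems(1)[OF that] by (simp add: completely_prime_ideal_def)
    have only: "\<exists>x\<in>J. x \<in> Q \<and> (\<forall>Q'\<in>\<P> - {Q}. x \<notin> Q')" if "Q \<in> \<P>" for Q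
    proof -
      have "\<not> J \<subseteq> \<Union>(\<P> - {Q})" using False that by blast
      then obtain x where "x \<in> J" "x \<notin> \<Union>(\<P> - {Q})" by blast
      moreover from this have "x \<in> \<Union>\<P>" using psubset.prems(2) by auto
      ultimately show ?thesis by auto
    qed
    have cancel: "y \<in> Q" if "Q \<in> \<P>" "x \<in> Q" "x \<oplus> y \<in> Q" "y \<in> carrier S" for Q x y
    proof -
      interpret ideal Q S by (rule id[OF that(1)])
      have "x \<in> carrier S" using that(2) by (rule Icarr)
      then have "y = \<ominus> x \<oplus> (x \<oplus> y)" using that(4) by (simp add: a_assoc[symmetric] l_neg)
      then show ?thesis
        using that(2,3) by (metis additive_subgroup.a_closed additive_subgroup.a_inv_closed
            is_additive_subgroup)
    qed
    have "J \<subseteq> P"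
    proof (rule ccontr)
      assume "\<not> J \<subseteq> P"
      then obtain z where z: "z \<in> J" "z \<notin> P" "\<forall>Q\<in>\<P> - {P}. z \<in> Q"
      proof -
        have "\<exists>x\<in>J. x \<in> Q \<and> x \<notin> P" if "Q \<in> \<P> - {P}" for Q
          using only[of Q] that P by auto
        with \<open>\<not> J \<subseteq> P\<close> have "\<exists>z\<in>J. z \<notin> P \<and> (\<forall>Q\<in>\<P> - {P}. z \<in> Q)"
          using psubset.hyps id J(1,4)
          by (intro completely_prime_avoid_simultaneous[OF _ _ cp]) auto
        then show ?thesis using that by blast
      qed
      obtain x where x: "x \<in> J" "x \<in> P" "\<forall>Q\<in>\<P> - {P}. x \<notin> Q" using only[OF P] by blast
      obtain Q where Q: "Q \<in> \<P>" "x \<oplus> z \<in> Q" using J(3) x(1) z(1) psubset.prems(2) by blast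
      interpret ideal P S by (rule id[OF P])
      have carr: "x \<in> carrier S" "z \<in> carrier S" using x(1) z(1) J(1) by auto
      show False
      proof (cases "Q = P")
        case True
        then show False using cancel[OF P x(2)] Q(2) carr z(2) by blast
      next
        case False
        then have "x \<in> Q" using cancel[of Q z x] Q z(3) carr by (auto simp: a_comm)
        then show False using x(3) Q(1) False by blast
      qed
    qed
    then show ?thesis using P by blast
  qed
qed

lemma right_ideal_with_unit:
  assumes "ring S" and "right_ideal J S" and "x \<in> J" and "x \<in> Units S"
  shows "J = carrier S"
proof -
  interpret ring S by fact
  interpret J: additive_subgroup J S using assms(2) by (simp add: right_ideal_def)
  have "x \<otimes>\<^bsub>S\<^esub> inv\<^bsub>S\<^esub> x \<in> J"
    using assms(2,3) Units_inv_closed[OF assms(4)] unfolding right_ideal_def by blast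
  then have one: "\<one>\<^bsub>S\<^esub> \<in> J" using assms(4) by simp
  have "s \<in> J" if "s \<in> carrier S" for s
  proof -
    have "\<one>\<^bsub>S\<^esub> \<otimes>\<^bsub>S\<^esub> s \<in> J" using one that assms(2) unfolding right_ideal_def by blast
    then show ?thesis using that by simp
  qed
  then show ?thesis using J.a_subset by blast
qed

lemma left_ideal_with_unit:
  assumes "ring S" and "left_ideal J S" and "x \<in> J" and "x \<in> Units S"
  shows "J = carrier S"
proof -
  interpret ring S by fact
  interpret J: additive_subgroup J S using assms(2) by (simp add: left_ideal_def)
  have "inv\<^bsub>S\<^esub> x \<otimes>\<^bsub>S\<^esub> x \<in> J"
    using assms(2,3) Units_inv_closed[OF assms(4)] unfolding left_ideal_def by blast
  then have one: "\<one>\<^bsub>S\<^esub> \<in> J" using assms(4) by simp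
  have "s \<in> J" if "s \<in> carrier S" for s
  proof -
    have "s \<otimes>\<^bsub>S\<^esub> \<one>\<^bsub>S\<^esub> \<in> J" using one that assms(2) unfolding left_ideal_def by blast
    then show ?thesis using that by simp
  qed
  then show ?thesis using J.a_subset by blast
qed

text \<open>Every non-unit lies in some member of \<open>\<P>\<close>, hence so does every element of a proper right
  ideal; avoidance then places a maximal one inside a single proper two-sided ideal.\<close>

lemma maximal_right_ideal_mem_of_units:
  assumes "ring S" and fin: "finite \<P>" and cp: "\<And>P. P \<in> \<P> \<Longrightarrow> completely_prime_ideal P S"
    and units: "carrier S - \<Union>\<P> \<subseteq> Units S" and max: "maximal_right_ideal J S"
  shows "J \<in> \<P>"
proof -
  have J: "right_ideal J S" "J \<noteq> carrier S" using max by (auto simp: maximal_right_ideal_def)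
  interpret J: additive_subgroup J S using J(1) by (simp add: right_ideal_def)
  have "J \<subseteq> \<Union>\<P>"
    using right_ideal_with_unit[OF assms(1) J(1)] J(2) J.a_subset units by blast
  moreover have "x \<otimes>\<^bsub>S\<^esub> y \<in> J" if "x \<in> J" "y \<in> J" for x y
    using J(1) that J.a_subset by (auto simp: right_ideal_def)
  ultimately obtain P where P: "P \<in> \<P>" "J \<subseteq> P"
    using completely_prime_avoidance[OF fin cp, of J] J.a_subset J.zero_closed by blast
  then have "ideal P S" "P \<noteq> carrier S" using cp by (auto simp: completely_prime_ideal_def)
  then have "right_ideal P S"
    by (auto simp: right_ideal_def ideal.axioms(1) intro: ideal.I_r_closed)
  then show ?thesis using max P \<open>P \<noteq> carrier S\<close> by (auto simp: maximal_right_ideal_def)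
qed

lemma maximal_left_ideal_mem_of_units:
  assumes "ring S" and fin: "finite \<P>" and cp: "\<And>P. P \<in> \<P> \<Longrightarrow> completely_prime_ideal P S"
    and units: "carrier S - \<Union>\<P> \<subseteq> Units S" and max: "maximal_left_ideal J S"
  shows "J \<in> \<P>"
proof -
  have J: "left_ideal J S" "J \<noteq> carrier S" using max by (auto simp: maximal_left_ideal_def)
  interpret J: additive_subgroup J S using J(1) by (simp add: left_ideal_def)
  have "J \<subseteq> \<Union>\<P>"
    using left_ideal_with_unit[OF assms(1) J(1)] J(2) J.a_subset units by blast
  moreover have "x \<otimes>\<^bsub>S\<^esub> y \<in> J" if "x \<in> J" "y \<in> J" for x y
    using J(1) that J.a_subset by (auto simp: left_ideal_def)
  ultimately obtain P where P: "P \<in> \<P>" "J \<subseteq> P"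
    using completely_prime_avoidance[OF fin cp, of J] J.a_subset J.zero_closed by blast
  then have "ideal P S" "P \<noteq> carrier S" using cp by (auto simp: completely_prime_ideal_def)
  then have "left_ideal P S"
    by (auto simp: left_ideal_def ideal.axioms(1) intro: ideal.I_l_closed)
  then show ?thesis using max P \<open>P \<noteq> carrier S\<close> by (auto simp: maximal_left_ideal_def)
qed


section \<open>Endomorphisms of a right module\<close>

lemma rmod_homD:
  assumes "f \<in> rmod_hom R M N"
  shows "x \<in> carrier M \<Longrightarrow> f x \<in> carrier N"
    and "\<lbrakk>x \<in> carrier M; y \<in> carrier M\<rbrakk> \<Longrightarrow> f (x \<oplus>\<^bsub>M\<^esub> y) = f x \<oplus>\<^bsub>N\<^esub> f y"
    and "\<lbrakk>x \<in> carrier M; r \<in> carrier R\<rbrakk> \<Longrightarrow> f (x \<cdot>\<^bsub>M\<^esub> r) = f x \<cdot>\<^bsub>N\<^esub> r"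
    and "f \<in> extensional (carrier M)"
  using assms by (auto simp: rmod_hom_def PiE_def)

lemma rmod_homI:
  assumes "f \<in> extensional (carrier M)" and "\<And>x. x \<in> carrier M \<Longrightarrow> f x \<in> carrier N"
    and "\<And>x y. \<lbrakk>x \<in> carrier M; y \<in> carrier M\<rbrakk> \<Longrightarrow> f (x \<oplus>\<^bsub>M\<^esub> y) = f x \<oplus>\<^bsub>N\<^esub> f y"
    and "\<And>x r. \<lbrakk>x \<in> carrier M; r \<in> carrier R\<rbrakk> \<Longrightarrow> f (x \<cdot>\<^bsub>M\<^esub> r) = f x \<cdot>\<^bsub>N\<^esub> r"
  shows "f \<in> rmod_hom R M N"
  using assms by (auto simp: rmod_hom_def PiE_def)

text \<open>Reduces statements on zero, negatives, kernels and images to the underlying additive groups.\<close>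

lemma rmod_hom_abelian_group_hom:
  assumes "right_module R M" "right_module R N" "f \<in> rmod_hom R M N"
  shows "abelian_group_hom M N f"
proof -
  interpret M: right_module R M by fact
  interpret N: right_module R N by fact
  show ?thesis
    by (rule abelian_group_homI[OF M.M.abelian_group_axioms N.M.abelian_group_axioms])
      (use M.M.a_group N.M.a_group rmod_homD[OF assms(3)] in
        \<open>auto intro!: group_hom.intro group_hom_axioms.intro simp: hom_def\<close>)
qed

text \<open>The operations are the components of those of \<^const>\<open>morph_End\<close>, so that the latter ring is
  literally a restriction of a direct product of two of these.\<close>

definition rmod_End ::
  "('r, 'k) ring_scheme \<Rightarrow> ('r, 'a, 'm) rmodule_scheme \<Rightarrow> ('a \<Rightarrow> 'a) ring" where
  "rmod_End R M =
     \<lparr>carrier = rmod_hom R M M,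
      monoid.mult = compose (carrier M),
      one = (\<lambda>x\<in>carrier M. x),
      zero = (\<lambda>x\<in>carrier M. \<zero>\<^bsub>M\<^esub>),
      add = (\<lambda>f g. \<lambda>x\<in>carrier M. f x \<oplus>\<^bsub>M\<^esub> g x)\<rparr>"

lemma rmod_End_simps [simp]:
  "carrier (rmod_End R M) = rmod_hom R M M"
  "f \<otimes>\<^bsub>rmod_End R M\<^esub> g = compose (carrier M) f g"
  "\<one>\<^bsub>rmod_End R M\<^esub> = (\<lambda>x\<in>carrier M. x)"
  "\<zero>\<^bsub>rmod_End R M\<^esub> = (\<lambda>x\<in>carrier M. \<zero>\<^bsub>M\<^esub>)"
  "f \<oplus>\<^bsub>rmod_End R M\<^esub> g = (\<lambda>x\<in>carrier M. f x \<oplus>\<^bsub>M\<^esub> g x)"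
  by (simp_all add: rmod_End_def)

context right_module
begin

text \<open>The left-hand sides do not determine the ring, source and target together, so these are
  instantiated for use as rewrite rules.\<close>

lemmas End_simps = rmod_homD[where R = R and M = M and N = M]

lemma zero_rsmult:
  assumes "r \<in> carrier R"
  shows "\<zero>\<^bsub>M\<^esub> \<cdot>\<^bsub>M\<^esub> r = \<zero>\<^bsub>M\<^esub>"
proof -
  have c: "\<zero>\<^bsub>M\<^esub> \<cdot>\<^bsub>M\<^esub> r \<in> carrier M" using assms by (simp add: rsmult_closed)
  have "\<zero>\<^bsub>M\<^esub> \<cdot>\<^bsub>M\<^esub> r \<oplus>\<^bsub>M\<^esub> \<zero>\<^bsub>M\<^esub> \<cdot>\<^bsub>M\<^esub> r = \<zero>\<^bsub>M\<^esub> \<cdot>\<^bsub>M\<^esub> r"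
    using rsmult_l_distr[of "\<zero>\<^bsub>M\<^esub>" "\<zero>\<^bsub>M\<^esub>" r] assms by simp
  then show ?thesis using c M.add.l_cancel_one by blast
qed

lemma minus_rsmult:
  assumes "x \<in> carrier M" "r \<in> carrier R"
  shows "(\<ominus>\<^bsub>M\<^esub> x) \<cdot>\<^bsub>M\<^esub> r = \<ominus>\<^bsub>M\<^esub> (x \<cdot>\<^bsub>M\<^esub> r)"
proof -
  have "(\<ominus>\<^bsub>M\<^esub> x) \<cdot>\<^bsub>M\<^esub> r \<oplus>\<^bsub>M\<^esub> x \<cdot>\<^bsub>M\<^esub> r = \<zero>\<^bsub>M\<^esub>"
    using rsmult_l_distr[of "\<ominus>\<^bsub>M\<^esub> x" x r] assms by (simp add: M.l_neg zero_rsmult)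
  then show ?thesis using assms by (simp add: M.minus_equality rsmult_closed)
qed

lemma minus_in_rmod_End:
  assumes "f \<in> rmod_hom R M M"
  shows "(\<lambda>x\<in>carrier M. \<ominus>\<^bsub>M\<^esub> f x) \<in> rmod_hom R M M"
  using assms by (intro rmod_homI) (auto simp: End_simps M.minus_add rsmult_closed minus_rsmult)

lemma rmod_End_ring: "ring (rmod_End R M)"
proof (intro ringI abelian_groupI monoidI)
  show "f \<oplus>\<^bsub>rmod_End R M\<^esub> g \<in> carrier (rmod_End R M)"
    if "f \<in> carrier (rmod_End R M)" "g \<in> carrier (rmod_End R M)" for f g
    using that by (auto intro!: rmod_homI simp: End_simps M.a_ac rsmult_l_distr rsmult_closed)
  show "\<zero>\<^bsub>rmod_End R M\<^esub> \<in> carrier (rmod_End R M)"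
    by (auto intro!: rmod_homI simp: zero_rsmult rsmult_closed)
  show "\<exists>g\<in>carrier (rmod_End R M). g \<oplus>\<^bsub>rmod_End R M\<^esub> f = \<zero>\<^bsub>rmod_End R M\<^esub>"
    if "f \<in> carrier (rmod_End R M)" for f
    using that minus_in_rmod_End[of f]
    by (intro bexI[of _ "\<lambda>x\<in>carrier M. \<ominus>\<^bsub>M\<^esub> f x"])
      (auto simp: End_simps M.l_neg intro!: restrict_ext)
  show "f \<otimes>\<^bsub>rmod_End R M\<^esub> g \<in> carrier (rmod_End R M)"
    if "f \<in> carrier (rmod_End R M)" "g \<in> carrier (rmod_End R M)" for f g
    using that by (auto intro!: rmod_homI simp: End_simps compose_def rsmult_closed)
  show "\<one>\<^bsub>rmod_End R M\<^esub> \<in> carrier (rmod_End R M)"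
    by (auto intro!: rmod_homI simp: rsmult_closed)
qed (auto simp: End_simps compose_def M.a_ac intro!: restrict_ext extensionalityI[of _ "carrier M"])

lemma rmod_End_minus:
  assumes "f \<in> rmod_hom R M M" "x \<in> carrier M"
  shows "(\<ominus>\<^bsub>rmod_End R M\<^esub> f) x = \<ominus>\<^bsub>M\<^esub> f x"
proof -
  interpret E: ring "rmod_End R M" by (rule rmod_End_ring)
  have "(\<lambda>x\<in>carrier M. \<ominus>\<^bsub>M\<^esub> f x) = \<ominus>\<^bsub>rmod_End R M\<^esub> f"
    using minus_in_rmod_End[OF assms(1)] rmod_homD(1)[OF assms(1)] assms(1)
    by (intro E.minus_equality[symmetric]) (auto simp: M.l_neg restrict_def)
  then show ?thesis using assms(2) by (metis restrict_apply')
qed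

lemma kernel_rsubmodule:
  assumes "f \<in> rmod_hom R M M"
  shows "rsubmodule R M (a_kernel M M f)"
proof -
  interpret f: abelian_group_hom M M f
    using rmod_hom_abelian_group_hom[OF right_module_axioms right_module_axioms assms] .
  (* Kernel membership is unfolded: as a rewrite rule it would loop with f.kernel_zero. *)
  have "x \<cdot>\<^bsub>M\<^esub> r \<in> a_kernel M M f" if "x \<in> a_kernel M M f" "r \<in> carrier R" for x r
    using that rmod_homD(3)[OF assms, of x r] unfolding a_kernel_def'
    by (simp add: rsmult_closed zero_rsmult)
  then show ?thesis
    using f.additive_subgroup_a_kernel by (simp add: rsubmodule_def)
qed

lemma image_rsubmodule:
  assumes "f \<in> rmod_hom R M M"
  shows "rsubmodule R M (f ` carrier M)"
proof -
  interpret f: abelian_group_hom M M f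
    using rmod_hom_abelian_group_hom[OF right_module_axioms right_module_axioms assms] .
  have "additive_subgroup (f ` carrier M) M"
    using f.a_group_hom group_hom.img_is_subgroup additive_subgroup.intro by fastforce
  then show ?thesis
    using rmod_homD(3)[OF assms, symmetric]
    by (auto simp: rsubmodule_def rsmult_closed)
qed

lemma inj_iff_kernel:
  assumes "f \<in> rmod_hom R M M"
  shows "inj_on f (carrier M) \<longleftrightarrow> a_kernel M M f = {\<zero>\<^bsub>M\<^esub>}"
proof -
  interpret f: abelian_group_hom M M f
    using rmod_hom_abelian_group_hom[OF right_module_axioms right_module_axioms assms] .
  show ?thesis
    using group_hom.inj_iff_trivial_ker[OF f.a_group_hom] by (simp add: a_kernel_def)
qed

end


section \<open>Endomorphisms of a uniserial module\<close>

locale nonzero_uniserial = right_module +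
  assumes submodules_linear: "\<lbrakk>rsubmodule R M N; rsubmodule R M N'\<rbrakk> \<Longrightarrow> N \<subseteq> N' \<or> N' \<subseteq> N"
    and nonzero: "carrier M \<noteq> {\<zero>\<^bsub>M\<^esub>}"
begin

text \<open>If \<open>f g\<close> is injective, the kernel of \<open>f\<close> meets the image of \<open>g\<close> trivially.  The two are
  comparable and the image is non-zero, so the kernel must be zero.\<close>

lemma inj_compose_iff:
  assumes f: "f \<in> rmod_hom R M M" and g: "g \<in> rmod_hom R M M"
  shows "inj_on (compose (carrier M) f g) (carrier M)
    \<longleftrightarrow> inj_on f (carrier M) \<and> inj_on g (carrier M)"
proof
  assume inj: "inj_on (compose (carrier M) f g) (carrier M)"
  have fg: "f (g x) = f (g y) \<longleftrightarrow> x = y" if "x \<in> carrier M" "y \<in> carrier M" for x y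
    using inj that by (auto simp: inj_on_def compose_eq)
  then have "inj_on g (carrier M)" by (metis inj_onI)
  interpret f: abelian_group_hom M M f
    using rmod_hom_abelian_group_hom[OF right_module_axioms right_module_axioms f] .
  interpret g: abelian_group_hom M M g
    using rmod_hom_abelian_group_hom[OF right_module_axioms right_module_axioms g] .
  have meet: "y = \<zero>\<^bsub>M\<^esub>" if y: "y \<in> a_kernel M M f" "y \<in> g ` carrier M" for y
  proof -
    obtain x where "x \<in> carrier M" "y = g x" using y(2) by blast
    moreover have "f (g x) = f (g \<zero>\<^bsub>M\<^esub>)"
      using y(1) \<open>y = g x\<close> unfolding a_kernel_def' by simp
    ultimately show ?thesis using fg[of x "\<zero>\<^bsub>M\<^esub>"] by simp
  qed
  have "\<not> g ` carrier M \<subseteq> a_kernel M M f"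
  proof
    assume "g ` carrier M \<subseteq> a_kernel M M f"
    then have "f (g x) = \<zero>\<^bsub>M\<^esub>" if "x \<in> carrier M" for x
      using that unfolding a_kernel_def' by auto
    then have "x = \<zero>\<^bsub>M\<^esub>" if "x \<in> carrier M" for x
      using that fg[of x "\<zero>\<^bsub>M\<^esub>"] by simp
    then show False using nonzero by blast
  qed
  then have "a_kernel M M f \<subseteq> g ` carrier M"
    using submodules_linear[OF kernel_rsubmodule[OF f] image_rsubmodule[OF g]] by blast
  moreover have "\<zero>\<^bsub>M\<^esub> \<in> a_kernel M M f" unfolding a_kernel_def' by simp
  ultimately have "a_kernel M M f = {\<zero>\<^bsub>M\<^esub>}" using meet by blast
  then show "inj_on f (carrier M) \<and> inj_on g (carrier M)"
    using \<open>inj_on g (carrier M)\<close> inj_iff_kernel[OF f] by blast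
next
  assume "inj_on f (carrier M) \<and> inj_on g (carrier M)"
  then show "inj_on (compose (carrier M) f g) (carrier M)"
    using rmod_homD(1)[OF g] by (auto simp: inj_on_def compose_eq)
qed

text \<open>If \<open>f g\<close> is surjective, the module is the sum of the kernel of \<open>f\<close> and the image of \<open>g\<close>.
  The image is not inside the kernel, as \<open>f g\<close> is non-zero; so it contains the
  kernel and is everything.\<close>

lemma surj_compose_iff:
  assumes f: "f \<in> rmod_hom R M M" and g: "g \<in> rmod_hom R M M"
  shows "compose (carrier M) f g ` carrier M = carrier M
    \<longleftrightarrow> f ` carrier M = carrier M \<and> g ` carrier M = carrier M"
proof -
  have image_compose: "compose (carrier M) f g ` carrier M = f ` g ` carrier M"
    by (simp add: image_image compose_eq cong: image_cong)
  show ?thesis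
  proof
    assume "compose (carrier M) f g ` carrier M = carrier M"
    then have fg: "f ` g ` carrier M = carrier M" by (simp only: image_compose)
    have fM: "f ` carrier M \<subseteq> carrier M" and gM: "g ` carrier M \<subseteq> carrier M"
      using rmod_homD(1)[OF f] rmod_homD(1)[OF g] by auto
    then have "f ` carrier M = carrier M" using fg image_mono[OF gM, of f] by simp
    interpret f: abelian_group_hom M M f
      using rmod_hom_abelian_group_hom[OF right_module_axioms right_module_axioms f] .
    have "\<not> g ` carrier M \<subseteq> a_kernel M M f"
    proof
      assume "g ` carrier M \<subseteq> a_kernel M M f"
      then have "f ` g ` carrier M \<subseteq> {\<zero>\<^bsub>M\<^esub>}" unfolding a_kernel_def' by auto
      then have "carrier M \<subseteq> {\<zero>\<^bsub>M\<^esub>}" by (simp only: fg)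
      then show False using nonzero M.zero_closed by blast
    qed
    then have ker: "a_kernel M M f \<subseteq> g ` carrier M"
      using submodules_linear[OF kernel_rsubmodule[OF f] image_rsubmodule[OF g]] by blast
    interpret gM: additive_subgroup "g ` carrier M" M
      using image_rsubmodule[OF g] by (simp add: rsubmodule_def)
    (* y differs from a preimage z of f y inside the image of g only by an element of the kernel. *)
    have "y \<in> g ` carrier M" if y: "y \<in> carrier M" for y
    proof -
      obtain z where z: "z \<in> g ` carrier M" "f z = f y"
        using fg y rmod_homD(1)[OF f y] by (metis (no_types, lifting) imageE)
      have zc: "z \<in> carrier M" using z(1) gM by blast
      have "y \<ominus>\<^bsub>M\<^esub> z \<in> a_kernel M M f"
        using z zc y unfolding a_kernel_def' by (simp add: a_minus_def M.r_neg)
      then have "(y \<ominus>\<^bsub>M\<^esub> z) \<oplus>\<^bsub>M\<^esub> z \<in> g ` carrier M"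
        using ker z(1) by blast
      moreover have "(y \<ominus>\<^bsub>M\<^esub> z) \<oplus>\<^bsub>M\<^esub> z = y"
        using y zc by (simp add: a_minus_def M.a_assoc M.l_neg)
      ultimately show ?thesis by simp
    qed
    then show "f ` carrier M = carrier M \<and> g ` carrier M = carrier M"
      using \<open>f ` carrier M = carrier M\<close> gM by blast
  next
    assume "f ` carrier M = carrier M \<and> g ` carrier M = carrier M"
    then show "compose (carrier M) f g ` carrier M = carrier M"
      by (simp only: image_compose)
  qed
qed

text \<open>The sum vanishes on the intersection of the two kernels, which is the smaller one.\<close>

lemma not_inj_add:
  assumes f: "f \<in> rmod_hom R M M" "\<not> inj_on f (carrier M)"
    and g: "g \<in> rmod_hom R M M" "\<not> inj_on g (carrier M)"
  shows "\<not> inj_on (\<lambda>x\<in>carrier M. f x \<oplus>\<^bsub>M\<^esub> g x) (carrier M)"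
proof
  assume inj: "inj_on (\<lambda>x\<in>carrier M. f x \<oplus>\<^bsub>M\<^esub> g x) (carrier M)"
  interpret f: abelian_group_hom M M f
    using rmod_hom_abelian_group_hom[OF right_module_axioms right_module_axioms f(1)] .
  interpret g: abelian_group_hom M M g
    using rmod_hom_abelian_group_hom[OF right_module_axioms right_module_axioms g(1)] .
  have "x = \<zero>\<^bsub>M\<^esub>" if x: "x \<in> a_kernel M M f" "x \<in> a_kernel M M g" for x
  proof (rule inj_onD[OF inj])
    show "x \<in> carrier M" using x(1) unfolding a_kernel_def' by simp
    then show "(\<lambda>x\<in>carrier M. f x \<oplus>\<^bsub>M\<^esub> g x) x = (\<lambda>x\<in>carrier M. f x \<oplus>\<^bsub>M\<^esub> g x) \<zero>\<^bsub>M\<^esub>"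
      using x by simp
  qed simp
  moreover have "\<zero>\<^bsub>M\<^esub> \<in> a_kernel M M f" "\<zero>\<^bsub>M\<^esub> \<in> a_kernel M M g" unfolding a_kernel_def' by auto
  ultimately have "a_kernel M M f = {\<zero>\<^bsub>M\<^esub>} \<or> a_kernel M M g = {\<zero>\<^bsub>M\<^esub>}"
    using submodules_linear[OF kernel_rsubmodule[OF f(1)] kernel_rsubmodule[OF g(1)]] by blast
  then show False using f g inj_iff_kernel by blast
qed

text \<open>The image of the sum lies in the larger of the two images.\<close>

lemma not_surj_add:
  assumes f: "f \<in> rmod_hom R M M" "f ` carrier M \<noteq> carrier M"
    and g: "g \<in> rmod_hom R M M" "g ` carrier M \<noteq> carrier M"
  shows "(\<lambda>x\<in>carrier M. f x \<oplus>\<^bsub>M\<^esub> g x) ` carrier M \<noteq> carrier M"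
proof
  assume surj: "(\<lambda>x\<in>carrier M. f x \<oplus>\<^bsub>M\<^esub> g x) ` carrier M = carrier M"
  have *: "carrier M \<subseteq> N" if N: "rsubmodule R M N" "f ` carrier M \<subseteq> N" "g ` carrier M \<subseteq> N" for N
  proof -
    interpret additive_subgroup N M using N(1) by (simp add: rsubmodule_def)
    have "(\<lambda>x\<in>carrier M. f x \<oplus>\<^bsub>M\<^esub> g x) ` carrier M \<subseteq> N" using N(2,3) by auto
    then show ?thesis using surj by simp
  qed
  have "carrier M \<subseteq> f ` carrier M \<or> carrier M \<subseteq> g ` carrier M"
    using submodules_linear[OF image_rsubmodule[OF f(1)] image_rsubmodule[OF g(1)]]
      *[OF image_rsubmodule[OF f(1)]] *[OF image_rsubmodule[OF g(1)]] by blast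
  then show False
    using f g rmod_homD(1)[OF f(1)] rmod_homD(1)[OF g(1)] by blast
qed

proposition not_inj_completely_prime:
  "completely_prime_ideal {f \<in> rmod_hom R M M. \<not> inj_on f (carrier M)} (rmod_End R M)"
proof (rule completely_prime_idealI[OF rmod_End_ring])
  interpret E: ring "rmod_End R M" by (rule rmod_End_ring)
  obtain x where "x \<in> carrier M" "x \<noteq> \<zero>\<^bsub>M\<^esub>" using nonzero by auto
  then have "\<not> inj_on (\<lambda>x\<in>carrier M. \<zero>\<^bsub>M\<^esub>) (carrier M)"
    using inj_onD[of "\<lambda>x\<in>carrier M. \<zero>\<^bsub>M\<^esub>" "carrier M" x "\<zero>\<^bsub>M\<^esub>"] by auto
  then show "\<zero>\<^bsub>rmod_End R M\<^esub> \<in> {f \<in> rmod_hom R M M. \<not> inj_on f (carrier M)}"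
    using E.zero_closed by simp
  show "f \<oplus>\<^bsub>rmod_End R M\<^esub> g \<in> {f \<in> rmod_hom R M M. \<not> inj_on f (carrier M)}"
    if "f \<in> {f \<in> rmod_hom R M M. \<not> inj_on f (carrier M)}"
      "g \<in> {f \<in> rmod_hom R M M. \<not> inj_on f (carrier M)}" for f g
    using that not_inj_add E.a_closed[of f g] by auto
  show "f \<otimes>\<^bsub>rmod_End R M\<^esub> g \<in> {f \<in> rmod_hom R M M. \<not> inj_on f (carrier M)}
      \<longleftrightarrow> f \<in> {f \<in> rmod_hom R M M. \<not> inj_on f (carrier M)}
        \<or> g \<in> {f \<in> rmod_hom R M M. \<not> inj_on f (carrier M)}"
    if "f \<in> carrier (rmod_End R M)" "g \<in> carrier (rmod_End R M)" for f g
    using that inj_compose_iff[of f g] E.m_closed[of f g] by auto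
qed auto

proposition not_surj_completely_prime:
  "completely_prime_ideal {f \<in> rmod_hom R M M. f ` carrier M \<noteq> carrier M} (rmod_End R M)"
proof (rule completely_prime_idealI[OF rmod_End_ring])
  interpret E: ring "rmod_End R M" by (rule rmod_End_ring)
  show "\<zero>\<^bsub>rmod_End R M\<^esub> \<in> {f \<in> rmod_hom R M M. f ` carrier M \<noteq> carrier M}"
    using E.zero_closed nonzero by (auto simp: image_def)
  show "f \<oplus>\<^bsub>rmod_End R M\<^esub> g \<in> {f \<in> rmod_hom R M M. f ` carrier M \<noteq> carrier M}"
    if "f \<in> {f \<in> rmod_hom R M M. f ` carrier M \<noteq> carrier M}"
      "g \<in> {f \<in> rmod_hom R M M. f ` carrier M \<noteq> carrier M}" for f g
    using that not_surj_add[of f g] E.a_closed[of f g] by simp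
  show "f \<otimes>\<^bsub>rmod_End R M\<^esub> g \<in> {f \<in> rmod_hom R M M. f ` carrier M \<noteq> carrier M}
      \<longleftrightarrow> f \<in> {f \<in> rmod_hom R M M. f ` carrier M \<noteq> carrier M}
        \<or> g \<in> {f \<in> rmod_hom R M M. f ` carrier M \<noteq> carrier M}"
    if "f \<in> carrier (rmod_End R M)" "g \<in> carrier (rmod_End R M)" for f g
    using that surj_compose_iff[of f g] E.m_closed[of f g] by auto
qed auto

end


section \<open>Endomorphisms of a morphism of modules\<close>

text \<open>The ring axioms for endomorphisms of \<open>M\<close> are inherited from the product ring once the
  commuting pairs are seen to form a subring of it.\<close>

lemma morph_End_eq_RDirProd:
  "morph_End R M = (RDirProd (rmod_End R (src M)) (rmod_End R (tgt M)))\<lparr>carrier := morph_hom R M M\<rparr>"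
  by (simp add: morph_End_def RDirProd_def DirProd_def monoid.defs rmod_End_def)

lemma morph_End_ring:
  assumes "is_morph_obj R M"
  shows "ring (morph_End R M)"
proof -
  interpret M0: right_module R "src M" using assms by (simp add: is_morph_obj_def)
  interpret M1: right_module R "tgt M" using assms by (simp add: is_morph_obj_def)
  have arr: "arr M \<in> rmod_hom R (src M) (tgt M)" using assms by (simp add: is_morph_obj_def)
  interpret arr: abelian_group_hom "src M" "tgt M" "arr M"
    using rmod_hom_abelian_group_hom[OF M0.right_module_axioms M1.right_module_axioms arr] .
  interpret E0: ring "rmod_End R (src M)" by (rule M0.rmod_End_ring)
  interpret E1: ring "rmod_End R (tgt M)" by (rule M1.rmod_End_ring)
  let ?D = "RDirProd (rmod_End R (src M)) (rmod_End R (tgt M))"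
  interpret D: ring ?D by (intro RDirProd_ring M0.rmod_End_ring M1.rmod_End_ring)
  have D_simps: "carrier ?D = rmod_hom R (src M) (src M) \<times> rmod_hom R (tgt M) (tgt M)"
    "\<one>\<^bsub>?D\<^esub> = (\<one>\<^bsub>rmod_End R (src M)\<^esub>, \<one>\<^bsub>rmod_End R (tgt M)\<^esub>)"
    "\<zero>\<^bsub>?D\<^esub> = (\<zero>\<^bsub>rmod_End R (src M)\<^esub>, \<zero>\<^bsub>rmod_End R (tgt M)\<^esub>)"
    "(f, g) \<otimes>\<^bsub>?D\<^esub> (f', g') = (f \<otimes>\<^bsub>rmod_End R (src M)\<^esub> f', g \<otimes>\<^bsub>rmod_End R (tgt M)\<^esub> g')"
    "(f, g) \<oplus>\<^bsub>?D\<^esub> (f', g') = (f \<oplus>\<^bsub>rmod_End R (src M)\<^esub> f', g \<oplus>\<^bsub>rmod_End R (tgt M)\<^esub> g')" for f g f' g'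
    by (simp_all add: RDirProd_def DirProd_def monoid.defs)
  (* Sums and zero stay folded below, so that the negation laws of the factors apply. *)
  have minus: "\<ominus>\<^bsub>?D\<^esub> (f, g) = (\<ominus>\<^bsub>rmod_End R (src M)\<^esub> f, \<ominus>\<^bsub>rmod_End R (tgt M)\<^esub> g)"
    if "f \<in> rmod_hom R (src M) (src M)" "g \<in> rmod_hom R (tgt M) (tgt M)" for f g
    using that E0.a_inv_closed[of f] E1.a_inv_closed[of g] E0.l_neg[of f] E1.l_neg[of g]
    by (intro D.minus_equality) (simp_all add: D_simps del: rmod_End_simps(5,4))
  have "subring (morph_hom R M M) ?D"
  proof (rule D.subringI)
    show "morph_hom R M M \<subseteq> carrier ?D" by (auto simp: morph_hom_def D_simps)
    show "\<one>\<^bsub>?D\<^esub> \<in> morph_hom R M M"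
      using E0.one_closed E1.one_closed rmod_homD(1)[OF arr] by (auto simp: morph_hom_def D_simps)
    fix u assume u: "u \<in> morph_hom R M M"
    obtain u0 u1 where uu: "u = (u0, u1)" by (cases u)
    have u0: "u0 \<in> rmod_hom R (src M) (src M)" and u1: "u1 \<in> rmod_hom R (tgt M) (tgt M)"
      and uc: "\<And>x. x \<in> carrier (src M) \<Longrightarrow> u1 (arr M x) = arr M (u0 x)"
      using u by (auto simp: morph_hom_def uu)
    show "\<ominus>\<^bsub>?D\<^esub> u \<in> morph_hom R M M"
      using E0.a_inv_closed[of u0] E1.a_inv_closed[of u1] u0 u1 uc rmod_homD(1)[OF arr] rmod_homD(1)[OF u0]
      by (auto simp: uu minus morph_hom_def M0.rmod_End_minus M1.rmod_End_minus)
    fix v assume v: "v \<in> morph_hom R M M"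
    obtain v0 v1 where vv: "v = (v0, v1)" by (cases v)
    have v0: "v0 \<in> rmod_hom R (src M) (src M)" and v1: "v1 \<in> rmod_hom R (tgt M) (tgt M)"
      and vc: "\<And>x. x \<in> carrier (src M) \<Longrightarrow> v1 (arr M x) = arr M (v0 x)"
      using v by (auto simp: morph_hom_def vv)
    note carr = rmod_homD(1)[OF arr] rmod_homD(1)[OF u0] rmod_homD(1)[OF v0]
    show "u \<otimes>\<^bsub>?D\<^esub> v \<in> morph_hom R M M"
      using E0.m_closed[of u0 v0] E1.m_closed[of u1 v1] u0 u1 v0 v1 uc vc carr
      by (auto simp: uu vv D_simps morph_hom_def compose_eq)
    show "u \<oplus>\<^bsub>?D\<^esub> v \<in> morph_hom R M M"
      using E0.a_closed[of u0 v0] E1.a_closed[of u1 v1] u0 u1 v0 v1 uc vc carr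
      by (auto simp: uu vv D_simps morph_hom_def)
  qed
  then show ?thesis
    unfolding morph_End_eq_RDirProd by (rule D.subring_is_ring)
qed

lemma morph_End_fst_hom:
  assumes "is_morph_obj R M"
  shows "ring_hom_ring (morph_End R M) (rmod_End R (src M)) fst"
proof (rule ring_hom_ringI[OF morph_End_ring[OF assms] right_module.rmod_End_ring])
  show "right_module R (src M)" using assms by (simp add: is_morph_obj_def)
qed (auto simp: morph_End_def morph_hom_def)

lemma morph_End_snd_hom:
  assumes "is_morph_obj R M"
  shows "ring_hom_ring (morph_End R M) (rmod_End R (tgt M)) snd"
proof (rule ring_hom_ringI[OF morph_End_ring[OF assms] right_module.rmod_End_ring])
  show "right_module R (tgt M)" using assms by (simp add: is_morph_obj_def)
qed (auto simp: morph_End_def morph_hom_def)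

lemma rmod_hom_inverse:
  assumes "right_module R M" and f: "f \<in> rmod_hom R M M"
    and bij: "bij_betw f (carrier M) (carrier M)"
  shows "(\<lambda>x\<in>carrier M. inv_into (carrier M) f x) \<in> rmod_hom R M M"
proof -
  interpret right_module R M by fact
  let ?g = "inv_into (carrier M) f"
  have gc: "?g x \<in> carrier M" and fg: "f (?g x) = x" if "x \<in> carrier M" for x
    using that bij by (auto simp: bij_betw_def inv_into_into f_inv_into_f)
  have gf: "?g (f x) = x" if "x \<in> carrier M" for x
    using that bij by (simp add: bij_betw_def)
  have "?g (x \<oplus>\<^bsub>M\<^esub> y) = ?g x \<oplus>\<^bsub>M\<^esub> ?g y" if "x \<in> carrier M" "y \<in> carrier M" for x y
    using gf[of "?g x \<oplus>\<^bsub>M\<^esub> ?g y"] that gc fg by (simp add: rmod_homD(2)[OF f])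
  moreover have "?g (x \<cdot>\<^bsub>M\<^esub> r) = ?g x \<cdot>\<^bsub>M\<^esub> r" if "x \<in> carrier M" "r \<in> carrier R" for x r
    using gf[of "?g x \<cdot>\<^bsub>M\<^esub> r"] that gc fg by (simp add: rmod_homD(3)[OF f] rsmult_closed)
  ultimately show ?thesis
    using gc by (auto simp: rmod_hom_def rsmult_closed)
qed

text \<open>The inverse pair is a morphism because \<open>u\<^sub>1 a = a u\<^sub>0\<close>, with \<open>a\<close> the arrow of \<open>M\<close>, gives
  \<open>a u\<^sub>0\<^sup>-\<^sup>1 = u\<^sub>1\<^sup>-\<^sup>1 a\<close>.\<close>

lemma morph_End_unitI:
  assumes "is_morph_obj R M" and u: "(u0, u1) \<in> carrier (morph_End R M)"
    and bij0: "bij_betw u0 (carrier (src M)) (carrier (src M))"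
    and bij1: "bij_betw u1 (carrier (tgt M)) (carrier (tgt M))"
  shows "(u0, u1) \<in> Units (morph_End R M)"
proof -
  have M0: "right_module R (src M)" and M1: "right_module R (tgt M)"
    and arr: "arr M \<in> rmod_hom R (src M) (tgt M)"
    using assms(1) by (auto simp: is_morph_obj_def)
  have u0: "u0 \<in> rmod_hom R (src M) (src M)" and u1: "u1 \<in> rmod_hom R (tgt M) (tgt M)"
    and uc: "\<And>x. x \<in> carrier (src M) \<Longrightarrow> u1 (arr M x) = arr M (u0 x)"
    using u by (auto simp: morph_End_def morph_hom_def)
  define v0 where "v0 = (\<lambda>x\<in>carrier (src M). inv_into (carrier (src M)) u0 x)"
  define v1 where "v1 = (\<lambda>x\<in>carrier (tgt M). inv_into (carrier (tgt M)) u1 x)"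
  have v0: "v0 \<in> rmod_hom R (src M) (src M)" and v1: "v1 \<in> rmod_hom R (tgt M) (tgt M)"
    using rmod_hom_inverse[OF M0 u0 bij0] rmod_hom_inverse[OF M1 u1 bij1]
    by (simp_all add: v0_def v1_def)
  have inv: "compose (carrier (src M)) u0 v0 = (\<lambda>x\<in>carrier (src M). x)"
    "compose (carrier (src M)) v0 u0 = (\<lambda>x\<in>carrier (src M). x)"
    "compose (carrier (tgt M)) u1 v1 = (\<lambda>x\<in>carrier (tgt M). x)"
    "compose (carrier (tgt M)) v1 u1 = (\<lambda>x\<in>carrier (tgt M). x)"
    unfolding v0_def v1_def
    using bij0 bij1 by (simp_all add: compose_id_inv_into compose_inv_into_id bij_betw_def)
  have "v1 (arr M x) = arr M (v0 x)" if x: "x \<in> carrier (src M)" for x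
  proof -
    have v0x: "v0 x \<in> carrier (src M)" using rmod_homD(1)[OF v0 x] .
    have "x = u0 (v0 x)" using fun_cong[OF inv(1), of x] x by (simp add: compose_eq)
    then have "v1 (arr M x) = v1 (u1 (arr M (v0 x)))" using uc[OF v0x] by simp
    also have "\<dots> = arr M (v0 x)"
      using fun_cong[OF inv(4), of "arr M (v0 x)"] rmod_homD(1)[OF arr v0x] by (simp add: compose_eq)
    finally show ?thesis .
  qed
  then have "(v0, v1) \<in> carrier (morph_End R M)"
    using v0 v1 by (simp add: morph_End_def morph_hom_def)
  moreover have "(v0, v1) \<otimes>\<^bsub>morph_End R M\<^esub> (u0, u1) = \<one>\<^bsub>morph_End R M\<^esub>"
    "(u0, u1) \<otimes>\<^bsub>morph_End R M\<^esub> (v0, v1) = \<one>\<^bsub>morph_End R M\<^esub>"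
    using inv by (simp_all add: morph_End_def)
  ultimately show ?thesis using u unfolding Units_def by blast
qed

theorem proposition7p1:
  fixes R :: "('r, 'k) ring_scheme"
    and M :: "('r, 'a, 'b) morph_obj"
  assumes "ring R" and "\<one>\<^bsub>R\<^esub> \<noteq> \<zero>\<^bsub>R\<^esub>"
    and "is_morph_obj R M"
    and "uniserial R (src M)" and "carrier (src M) \<noteq> {\<zero>\<^bsub>src M\<^esub>}"
    and "uniserial R (tgt M)" and "carrier (tgt M) \<noteq> {\<zero>\<^bsub>tgt M\<^esub>}"
  shows "ring (morph_End R M)
    \<and> completely_prime_ideal (nonmono_src R M) (morph_End R M)
    \<and> completely_prime_ideal (nonmono_tgt R M) (morph_End R M)
    \<and> completely_prime_ideal (nonepi_src R M) (morph_End R M)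
    \<and> completely_prime_ideal (nonepi_tgt R M) (morph_End R M)
    \<and> {J. maximal_right_ideal J (morph_End R M)}
        \<subseteq> {nonmono_src R M, nonmono_tgt R M, nonepi_src R M, nonepi_tgt R M}
    \<and> card {J. maximal_right_ideal J (morph_End R M)} \<le> 4
    \<and> {J. maximal_left_ideal J (morph_End R M)}
        \<subseteq> {nonmono_src R M, nonmono_tgt R M, nonepi_src R M, nonepi_tgt R M}
    \<and> card {J. maximal_left_ideal J (morph_End R M)} \<le> 4"
proof -
  let ?E = "morph_End R M"
  let ?\<P> = "{nonmono_src R M, nonmono_tgt R M, nonepi_src R M, nonepi_tgt R M}"
  have ring: "ring ?E" by (rule morph_End_ring[OF assms(3)])
  interpret M0: nonzero_uniserial R "src M"
    using assms(4,5) by (simp add: uniserial_def nonzero_uniserial_def nonzero_uniserial_axioms_def)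
  interpret M1: nonzero_uniserial R "tgt M"
    using assms(6,7) by (simp add: uniserial_def nonzero_uniserial_def nonzero_uniserial_axioms_def)
  note fst_vimage = completely_prime_ideal_vimage[OF morph_End_fst_hom[OF assms(3)]]
  note snd_vimage = completely_prime_ideal_vimage[OF morph_End_snd_hom[OF assms(3)]]
  have vimage:
    "nonmono_src R M = {u \<in> carrier ?E. fst u \<in> {f \<in> rmod_hom R (src M) (src M). \<not> inj_on f (carrier (src M))}}"
    "nonmono_tgt R M = {u \<in> carrier ?E. snd u \<in> {f \<in> rmod_hom R (tgt M) (tgt M). \<not> inj_on f (carrier (tgt M))}}"
    "nonepi_src R M = {u \<in> carrier ?E. fst u \<in> {f \<in> rmod_hom R (src M) (src M). f ` carrier (src M) \<noteq> carrier (src M)}}"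
    "nonepi_tgt R M = {u \<in> carrier ?E. snd u \<in> {f \<in> rmod_hom R (tgt M) (tgt M). f ` carrier (tgt M) \<noteq> carrier (tgt M)}}"
    by (auto simp: nonmono_src_def nonmono_tgt_def nonepi_src_def nonepi_tgt_def
        morph_End_def morph_hom_def)
  have cp: "completely_prime_ideal (nonmono_src R M) ?E" "completely_prime_ideal (nonmono_tgt R M) ?E"
    "completely_prime_ideal (nonepi_src R M) ?E" "completely_prime_ideal (nonepi_tgt R M) ?E"
    unfolding vimage
    by (intro fst_vimage snd_vimage M0.not_inj_completely_prime M1.not_inj_completely_prime
        M0.not_surj_completely_prime M1.not_surj_completely_prime)+
  then have cp\<P>: "completely_prime_ideal P ?E" if "P \<in> ?\<P>" for P
    using that by blast
  have units: "carrier ?E - \<Union>?\<P> \<subseteq> Units ?E"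
    using morph_End_unitI[OF assms(3)]
    by (auto simp: nonmono_src_def nonmono_tgt_def nonepi_src_def nonepi_tgt_def bij_betw_def)
  have right: "{J. maximal_right_ideal J ?E} \<subseteq> ?\<P>"
    using maximal_right_ideal_mem_of_units[OF ring _ cp\<P> units] by blast
  have left: "{J. maximal_left_ideal J ?E} \<subseteq> ?\<P>"
    using maximal_left_ideal_mem_of_units[OF ring _ cp\<P> units] by blast
  have "card ?\<P> \<le> 4"
    by (simp add: card_insert_if)
  then have "card {J. maximal_right_ideal J ?E} \<le> 4" "card {J. maximal_left_ideal J ?E} \<le> 4"
    using card_mono[OF _ right] card_mono[OF _ left] by auto
  then show ?thesis using ring cp right left by blast
qed

end
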